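(* For every $p\in[1,2)$ there is a finite constant $M(p)$, depending only on $p$, such that $m(\ell_p(\Gamma))\leq M(p)$ for every set $\Gamma$.
   Context: For a set $\Gamma$ and $p\in[1,\infty)$, $\ell_p(\Gamma)$ is the Banach space of all functions $x\colon\Gamma\to\mathbb{R}$ with $\sum_{n\in\Gamma}|x^{(n)}|^p<\infty$, with norm $\|x\|_p=\left(\sum_{n\in\Gamma}|x^{(n)}|^p\right)^{1/p}$. A subset $A$ of a normed space $X$ is $\lambda$-equilateral if $\|x-y\|=\lambda$ for all distinct $x,y\in A$; $A$ is equilateral if it is $\lambda$-equilateral for some $\lambda>0$. An equilateral set $A\subseteq X$ is maximal if there is no equilateral set $A'\subseteq X$ with $A\subsetneq A'$. $m(X)$ denotes the minimum cardinality of a maximal equilateral set in $X$. *)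

theory Defs
  imports "HOL-Analysis.Analysis" "HOL-Library.Extended_Nat"
begin

text \<open>
  A normed space is given by its carrier \<open>X\<close> and its norm \<open>N\<close>, because both the index
  set and the exponent of \<open>\<ell>\<^sub>p(\<Gamma>)\<close> are values rather than types. On functions,
  \<open>x - y\<close> is the pointwise difference.
\<close>

definition lam_equilateral :: "'v::minus set \<Rightarrow> ('v \<Rightarrow> real) \<Rightarrow> real \<Rightarrow> 'v set \<Rightarrow> bool" where
  "lam_equilateral X N lam A \<longleftrightarrow>
     A \<subseteq> X \<and> (\<forall>x\<in>A. \<forall>y\<in>A. x \<noteq> y \<longrightarrow> N (x - y) = lam)"

definition equilateral :: "'v::minus set \<Rightarrow> ('v \<Rightarrow> real) \<Rightarrow> 'v set \<Rightarrow> bool" where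
  "equilateral X N A \<longleftrightarrow> (\<exists>lam>0. lam_equilateral X N lam A)"

definition maximal_equilateral :: "'v::minus set \<Rightarrow> ('v \<Rightarrow> real) \<Rightarrow> 'v set \<Rightarrow> bool" where
  "maximal_equilateral X N A \<longleftrightarrow>
     equilateral X N A \<and> (\<nexists>A'. equilateral X N A' \<and> A \<subset> A')"

definition ecard :: "'v set \<Rightarrow> enat" where
  "ecard A = (if finite A then enat (card A) else \<infinity>)"

text \<open>
  Infinite cardinalities are all identified with \<open>\<infinity>\<close>. An infimum in \<^typ>\<open>enat\<close> over a
  nonempty family is attained, and over the empty family it is \<open>\<infinity>\<close>; hence a finite
  value of \<open>min_equilateral\<close> is always the size of a maximal equilateral set.
\<close>

definition min_equilateral :: "'v::minus set \<Rightarrow> ('v \<Rightarrow> real) \<Rightarrow> enat" where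
  "min_equilateral X N = (INF A\<in>{A. maximal_equilateral X N A}. ecard A)"

text \<open>
  Functions on \<open>\<Gamma>\<close> are represented by functions on the whole type that vanish outside
  \<open>\<Gamma>\<close>, so that each of them has exactly one representative.
\<close>

definition lp_space :: "real \<Rightarrow> 'a set \<Rightarrow> ('a \<Rightarrow> real) set" where
  "lp_space p \<Gamma> = {x. (\<forall>n. n \<notin> \<Gamma> \<longrightarrow> x n = 0) \<and> (\<lambda>n. \<bar>x n\<bar> powr p) summable_on \<Gamma>}"

definition lp_norm :: "real \<Rightarrow> 'a set \<Rightarrow> ('a \<Rightarrow> real) \<Rightarrow> real" where
  "lp_norm p \<Gamma> x = (\<Sum>\<^sub>\<infinity>n\<in>\<Gamma>. \<bar>x n\<bar> powr p) powr (1 / p)"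

definition m_lp :: "real \<Rightarrow> 'a set \<Rightarrow> enat" where
  "m_lp p \<Gamma> = min_equilateral (lp_space p \<Gamma>) (lp_norm p \<Gamma>)"

text \<open>
  The constant \<open>M(p)\<close>. Inside a formula one cannot quantify over all types, so a bound
  introduced by an existential quantifier could depend on the type of the elements of
  \<open>\<Gamma>\<close>. The constant below involves no type variable. It is no larger than any \<open>M(p)\<close>
  that bounds \<open>m(\<ell>\<^sub>p(\<Gamma>))\<close> for every \<open>\<Gamma>\<close>. If it is finite, it is itself such a bound:
  \<open>m(\<ell>\<^sub>p(\<Gamma>))\<close> depends only on the cardinality of \<open>\<Gamma>\<close>, every countable cardinality is
  realised by a set of reals, and if \<open>m(\<ell>\<^sub>p(\<Gamma>))\<close> is finite for one uncountable \<open>\<Gamma>\<close>, then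
  it has the same value for every uncountable \<open>\<Gamma>\<close>, since a finite equilateral set and
  any vector extending it have countable support.
\<close>

definition equilateral_bound :: "real \<Rightarrow> enat" where
  "equilateral_bound p = (SUP \<Gamma>::real set. m_lp p \<Gamma>)"

end

theory Submission
  imports Defs
begin

text \<open>
  Let \<open>H\<close> be a Hadamard matrix of order \<open>n\<close> whose first column is constant. Delete that column
  and place the rows on \<open>n - 1\<close> coordinates of \<open>\<Gamma>\<close>. Measured by \<open>p\<close>-th powers of norms, these
  \<open>n\<close> points have pairwise distance \<open>L = 2\<^sup>p n / 2\<close> and norm \<open>n - 1\<close>. The deleted matrix is rigid:
  orthogonality of the columns forces every vector \<open>y\<close> equidistant from all the rows to vanish on
  the \<open>n - 1\<close> coordinates (\<open>power_sum_of_equidistant\<close>). If moreover \<open>y\<close> extends the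
  \<open>n\<close> points to an equilateral set, its \<open>p\<close>-th power norm must be \<open>L - (n - 1)\<close>. The quotient
  \<open>(n - 1) / L\<close> tends to \<open>2 powr (1 - p)\<close>, which is more than \<open>1 / 2\<close> exactly because
  \<open>p < 2\<close>; so for large \<open>n\<close> all added points lie on a sphere whose radius, again in
  \<open>p\<close>-th powers, is \<open>r < L / 2\<close>.

  Such a sphere carries only boundedly many points at mutual distance \<open>L\<close>, in any dimension. The
  reason is that \<open>\<bar>s - t\<bar> powr p\<close> is a kernel of negative type for \<open>p < 2\<close>, which gives
  \<open>c (c - 1) L \<le> 2 c\<^sup>2 r\<close> for \<open>c\<close> points (\<open>card_equidistant_on_sphere_le\<close>). Hence every
  equilateral set containing the Hadamard points has bounded size, and a largest finite one is
  maximal. This covers all \<open>\<Gamma>\<close> with at least \<open>n - 1\<close> elements. For smaller \<open>\<Gamma>\<close> every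
  equilateral set is small by the pigeonhole principle (\<open>card_equilateral_finite_dim_le\<close>).

  The supremum in \<open>equilateral_bound\<close> ranges over sets of reals only, so finiteness still has to be
  carried over to index sets of other types. Vectors of \<open>\<ell>\<^sub>p(\<Gamma>)\<close> have countable support. A
  countable \<open>\<Gamma>\<close> can be renamed into a set of reals. For an uncountable \<open>\<Gamma>\<close>, a finite maximal
  equilateral set over the index set of all reals can be copied along an injection of its support, and
  a vector extending the copy could be copied back (\<open>m_lp_le_real_index\<close>).
\<close>

section \<open>Negative type of the p-th power distance\<close>

text \<open>
  For \<open>0 < p < 2\<close> the integral of this function over all \<open>t\<close> is a positive multiple of \<open>\<bar>u\<bar> powr p\<close>. Since
  \<open>1 - cos (t * (u - v))\<close> is of negative type for every frequency \<open>t\<close>, so is their mixture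
  \<open>\<bar>u - v\<bar> powr p\<close>.
\<close>
definition cos_kernel :: "real \<Rightarrow> real \<Rightarrow> real \<Rightarrow> real" where
  "cos_kernel p u t = indicator {0<..} t * ((1 - cos (t * u)) * t powr (- 1 - p))"

lemma cos_kernel_nonneg: "0 \<le> cos_kernel p u t"
  by (simp add: cos_kernel_def)

lemma borel_measurable_cos_kernel [measurable]: "cos_kernel p u \<in> borel_measurable borel"
  unfolding cos_kernel_def by measurable

text \<open>
  Substitute \<open>t\<close> by \<open>\<bar>u\<bar> * t\<close>. Extended nonnegative integrals permit this before the
  integral is known to be finite.
\<close>
lemma nn_integral_cos_kernel_scale:
  assumes "0 < p"
  shows "(\<integral>\<^sup>+t. ennreal (cos_kernel p u t) \<partial>lborel) =
         ennreal (\<bar>u\<bar> powr p) * (\<integral>\<^sup>+t. ennreal (cos_kernel p 1 t) \<partial>lborel)"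
proof (cases "u = 0")
  case True
  then show ?thesis by (simp add: cos_kernel_def)
next
  case False
  define c where "c = \<bar>u\<bar>"
  have c: "c > 0" using False by (simp add: c_def)
  have k: "ennreal (cos_kernel p 1 (0 + c * t)) = ennreal (c powr (- 1 - p)) * ennreal (cos_kernel p u t)" for t
  proof (cases "t > 0")
    case True
    have "cos (c * t) = cos (t * u)"
      unfolding c_def by (cases "u \<ge> 0") (auto simp: mult.commute)
    moreover have "(c * t) powr (- 1 - p) = c powr (- 1 - p) * t powr (- 1 - p)"
      using c True by (simp add: powr_mult)
    ultimately show ?thesis
      using c True by (simp add: cos_kernel_def flip: ennreal_mult)
  next
    case False
    then have "\<not> c * t > 0" using c by (simp add: zero_less_mult_iff)
    then show ?thesis using False by (simp add: cos_kernel_def)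
  qed
  have "(\<integral>\<^sup>+t. ennreal (cos_kernel p 1 t) \<partial>lborel) =
        ennreal c * (\<integral>\<^sup>+t. ennreal (cos_kernel p 1 (0 + c * t)) \<partial>lborel)"
    using nn_integral_real_affine[of "\<lambda>t. ennreal (cos_kernel p 1 t)" c 0] c by simp
  also have "\<dots> = ennreal c * (ennreal (c powr (- 1 - p)) * (\<integral>\<^sup>+t. ennreal (cos_kernel p u t) \<partial>lborel))"
    unfolding k by (subst nn_integral_cmult) auto
  finally have e: "(\<integral>\<^sup>+t. ennreal (cos_kernel p 1 t) \<partial>lborel) = \<dots>" .
  have "c powr p * (c * c powr (- 1 - p)) = 1"
    using c by (simp add: powr_mult_base flip: powr_add)
  then have "ennreal (c powr p) * (ennreal c * ennreal (c powr (- 1 - p))) = 1"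
    using c by (simp flip: ennreal_mult)
  then show ?thesis
    unfolding e c_def[symmetric] by (simp add: mult.assoc[symmetric])
qed

text \<open>
  Near \<open>0\<close> the kernel is dominated by \<open>t powr (1 - p)\<close>, which needs \<open>p < 2\<close>; at infinity it is
  dominated by \<open>2 * t powr (- 1 - p)\<close>, which needs \<open>p > 0\<close>.
\<close>
lemma nn_integral_cos_kernel_finite:
  assumes "0 < p" "p < 2"
  shows "(\<integral>\<^sup>+t. ennreal (cos_kernel p 1 t) \<partial>lborel) < \<infinity>"
proof -
  define f where "f t = indicator {0..1} t * t powr (1 - p)" for t :: real
  define g where "g t = indicator {1..} t * t powr (- 1 - p)" for t :: real
  have m [measurable]: "f \<in> borel_measurable borel" "g \<in> borel_measurable borel"
    unfolding f_def g_def by measurable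
  have le: "cos_kernel p 1 t \<le> f t + 2 * g t" for t
  proof (cases "0 < t")
    case True
    have c2: "1 - cos t \<le> 2" using cos_ge_minus_one[of t] by simp
    have "cos t = 1 - 2 * sin (t/2) ^ 2"
      using cos_double_sin[of "t/2"] by simp
    moreover have "sin (t/2) ^ 2 \<le> (t/2)^2"
      using abs_sin_x_le_abs_x[of "t/2"] by (metis power2_abs power_mono abs_ge_zero)
    ultimately have c1: "1 - cos t \<le> t^2" by (simp add: power_divide) (smt (verit) zero_le_power2)
    show ?thesis
    proof (cases "t \<le> 1")
      case le1: True
      have "(1 - cos t) * t powr (- 1 - p) \<le> t^2 * t powr (- 1 - p)"
        using c1 by (intro mult_right_mono) auto
      also have "\<dots> = t powr (1 - p)"
        using True powr_add[of t 2 "- 1 - p"] by simp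
      finally show ?thesis using True le1 by (simp add: cos_kernel_def f_def g_def add_increasing2)
    next
      case False
      then show ?thesis using True c2 by (simp add: cos_kernel_def f_def g_def mult_right_mono)
    qed
  next
    case False
    then show ?thesis by (simp add: cos_kernel_def f_def g_def)
  qed
  have "((\<lambda>t. t powr (1 - p)) has_integral (1 powr (1 - p + 1) / (1 - p + 1))) {0..1::real}"
    using assms by (intro has_integral_powr_from_0) auto
  then have If: "(\<integral>\<^sup>+t. ennreal (f t) \<partial>lborel) = ennreal (1 / (2 - p))"
    unfolding f_def by (subst nn_integral_has_integral_lebesgue) auto
  have "((\<lambda>t. t powr (- 1 - p)) has_integral (-(1 powr (- 1 - p + 1)) / (- 1 - p + 1))) {1::real..}"
    using assms by (intro has_integral_powr_to_inf) auto
  then have Ig: "(\<integral>\<^sup>+t. ennreal (g t) \<partial>lborel) = ennreal (1 / p)"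
    unfolding g_def by (subst nn_integral_has_integral_lebesgue) auto
  have "(\<integral>\<^sup>+t. ennreal (cos_kernel p 1 t) \<partial>lborel) \<le> (\<integral>\<^sup>+t. ennreal (f t) + 2 * ennreal (g t) \<partial>lborel)"
  proof (intro nn_integral_mono)
    fix t
    have "ennreal (cos_kernel p 1 t) \<le> ennreal (f t + 2 * g t)" by (rule ennreal_leI[OF le])
    also have "\<dots> = ennreal (f t) + 2 * ennreal (g t)"
      by (simp add: f_def g_def ennreal_mult)
    finally show "ennreal (cos_kernel p 1 t) \<le> ennreal (f t) + 2 * ennreal (g t)" .
  qed
  also have "\<dots> = ennreal (1 / (2 - p)) + 2 * ennreal (1 / p)"
    by (subst nn_integral_add) (auto simp: nn_integral_cmult If Ig)
  also have "\<dots> < \<infinity>" by (simp add: ennreal_mult_less_top)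
  finally show ?thesis .
qed

lemma nn_integral_cos_kernel_pos:
  "0 < (\<integral>\<^sup>+t. ennreal (cos_kernel p 1 t) \<partial>lborel)"
proof (rule ccontr)
  assume "\<not> ?thesis"
  then have "AE t in lborel. ennreal (cos_kernel p 1 t) = 0"
    by (subst nn_integral_0_iff_AE[symmetric]) auto
  then have "AE t in lborel. t \<notin> {1..2::real}"
  proof eventually_elim
    case (elim t)
    show ?case
    proof
      assume t: "t \<in> {1..2}"
      have "cos t < cos 0" using t pi_gt3 by (intro cos_monotone_0_pi) auto
      then show False using t elim by (simp add: cos_kernel_def mult_le_0_iff)
    qed
  qed
  then have "emeasure lborel {1..2::real} = 0"
    by (subst (asm) AE_iff_measurable[of "{1..2}"]) auto
  then show False by simp
qed

text \<open>
  With \<open>z\<close> the sum of the unit vectors \<open>(cos (t * x i), sin (t * x i))\<close> in the plane and \<open>n\<close> their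
  number, the right side exceeds the left by a multiple of the squared distance of \<open>z\<close> from
  \<open>(n, 0)\<close>.
\<close>
lemma cos_kernel_negative_type:
  assumes "finite I"
  shows "(\<Sum>i\<in>I. \<Sum>j\<in>I. cos_kernel p (x i - x j) t) \<le> 2 * card I * (\<Sum>i\<in>I. cos_kernel p (x i) t)"
proof -
  define n c s where "n = real (card I)" and "c = (\<Sum>i\<in>I. cos (t * x i))" and "s = (\<Sum>i\<in>I. sin (t * x i))"
  define w where "w = indicator {0<..} t * t powr (- 1 - p)"
  have k: "cos_kernel p u t = w * (1 - cos (t * u))" for u by (simp add: cos_kernel_def w_def)
  have "(\<Sum>i\<in>I. \<Sum>j\<in>I. 1 - cos (t * (x i - x j))) = n * n - (c * c + s * s)"
    unfolding right_diff_distrib cos_diff c_def s_def n_def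
    by (simp add: sum_subtractf sum.distrib sum_product)
  moreover have "2 * n * (\<Sum>i\<in>I. 1 - cos (t * x i)) = 2 * n * (n - c)"
    by (simp add: sum_subtractf c_def n_def)
  moreover have "n * n - (c * c + s * s) \<le> 2 * n * (n - c)"
    using sum_squares_ge_zero[of "n - c" s] by (simp add: algebra_simps)
  ultimately have *: "(\<Sum>i\<in>I. \<Sum>j\<in>I. 1 - cos (t * (x i - x j))) \<le> 2 * n * (\<Sum>i\<in>I. 1 - cos (t * x i))"
    by linarith
  have "w \<ge> 0" by (simp add: w_def)
  from mult_left_mono[OF * this] show ?thesis
    by (simp add: k n_def sum_distrib_left mult_ac)
qed

text \<open>
  In probabilistic terms: independent copies \<open>X, Y\<close> of a random variable satisfy
  \<open>E \<bar>X - Y\<bar>\<^sup>p \<le> 2 E \<bar>X\<bar>\<^sup>p\<close>. The inequality for the kernels is integrated over \<open>t\<close>.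
\<close>
lemma powr_negative_type:
  fixes x :: "'i \<Rightarrow> real"
  assumes "0 < p" "p < 2" "finite I"
  shows "(\<Sum>i\<in>I. \<Sum>j\<in>I. \<bar>x i - x j\<bar> powr p) \<le> 2 * card I * (\<Sum>i\<in>I. \<bar>x i\<bar> powr p)"
proof -
  obtain C where C: "0 \<le> C" "(\<integral>\<^sup>+t. ennreal (cos_kernel p 1 t) \<partial>lborel) = ennreal C"
    using nn_integral_cos_kernel_finite[OF assms(1,2)]
    by (cases "\<integral>\<^sup>+t. ennreal (cos_kernel p 1 t) \<partial>lborel" rule: ennreal_cases) auto
  then have "C > 0" using nn_integral_cos_kernel_pos[of p] by simp
  have bi: "has_bochner_integral lborel (cos_kernel p u) (\<bar>u\<bar> powr p * C)" for u
    using nn_integral_cos_kernel_scale[OF assms(1), of u] C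
    by (intro has_bochner_integral_nn_integral) (auto simp: cos_kernel_nonneg ennreal_mult)
  have L: "has_bochner_integral lborel (\<lambda>t. \<Sum>i\<in>I. \<Sum>j\<in>I. cos_kernel p (x i - x j) t)
          (\<Sum>i\<in>I. \<Sum>j\<in>I. \<bar>x i - x j\<bar> powr p * C)"
    by (intro has_bochner_integral_sum bi)
  have R: "has_bochner_integral lborel (\<lambda>t. 2 * card I * (\<Sum>i\<in>I. cos_kernel p (x i) t))
          (2 * card I * (\<Sum>i\<in>I. \<bar>x i\<bar> powr p * C))"
    by (intro has_bochner_integral_mult_right has_bochner_integral_sum bi)
  have "(\<Sum>i\<in>I. \<Sum>j\<in>I. \<bar>x i - x j\<bar> powr p * C) \<le> 2 * card I * (\<Sum>i\<in>I. \<bar>x i\<bar> powr p * C)"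
    using has_bochner_integral_integral_eq[OF L] has_bochner_integral_integral_eq[OF R]
      integral_mono[OF integrable.intros[OF L] integrable.intros[OF R] cos_kernel_negative_type[OF assms(3)]]
    by auto
  then have "(\<Sum>i\<in>I. \<Sum>j\<in>I. \<bar>x i - x j\<bar> powr p) * C \<le> (2 * card I * (\<Sum>i\<in>I. \<bar>x i\<bar> powr p)) * C"
    by (simp add: sum_distrib_right mult.assoc)
  then show ?thesis using \<open>C > 0\<close> by simp
qed

text \<open>
  The \<open>p\<close>-th power of the norm. Unlike the norm it is additive over coordinates, and it carries the
  same information about equilateral sets.
\<close>
definition power_sum :: "real \<Rightarrow> 'a set \<Rightarrow> ('a \<Rightarrow> real) \<Rightarrow> real" where
  "power_sum p \<Gamma> x = (\<Sum>\<^sub>\<infinity>n\<in>\<Gamma>. \<bar>x n\<bar> powr p)"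

lemma power_sum_nonneg: "0 \<le> power_sum p \<Gamma> x"
  unfolding power_sum_def by (intro infsum_nonneg) auto

lemma lp_norm_eq_iff:
  assumes "0 < p" "0 < lam"
  shows "lp_norm p \<Gamma> x = lam \<longleftrightarrow> power_sum p \<Gamma> x = lam powr p"
  using assms power_sum_nonneg[of p \<Gamma> x]
  by (auto simp: lp_norm_def power_sum_def[symmetric] powr_powr)

lemma lp_space_diff:
  assumes "0 < p" "x \<in> lp_space p \<Gamma>" "y \<in> lp_space p \<Gamma>"
  shows "x - y \<in> lp_space p \<Gamma>"
proof -
  have "(\<lambda>n. \<bar>x n - y n\<bar> powr p) summable_on \<Gamma>"
  proof (rule summable_on_comparison_test)
    show "(\<lambda>n. 2 powr p * (\<bar>x n\<bar> powr p + \<bar>y n\<bar> powr p)) summable_on \<Gamma>"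
      using assms by (intro summable_on_cmult_right summable_on_add) (auto simp: lp_space_def)
  next
    fix n
    have "\<bar>x n - y n\<bar> powr p \<le> (2 * max \<bar>x n\<bar> \<bar>y n\<bar>) powr p"
      using assms(1) by (intro powr_mono2) auto
    also have "\<dots> = 2 powr p * max \<bar>x n\<bar> \<bar>y n\<bar> powr p"
      by (simp add: powr_mult)
    also have "\<dots> \<le> 2 powr p * (\<bar>x n\<bar> powr p + \<bar>y n\<bar> powr p)"
      by (intro mult_left_mono) (auto simp: max_def)
    finally show "\<bar>x n - y n\<bar> powr p \<le> 2 powr p * (\<bar>x n\<bar> powr p + \<bar>y n\<bar> powr p)" .
  qed auto
  then show ?thesis using assms by (auto simp: lp_space_def)
qed

lemma has_sum_finite_sum:
  fixes f :: "'i \<Rightarrow> 'a \<Rightarrow> real"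
  assumes "finite I" "\<And>i. i \<in> I \<Longrightarrow> (f i has_sum s i) A"
  shows "((\<lambda>n. \<Sum>i\<in>I. f i n) has_sum (\<Sum>i\<in>I. s i)) A"
  using assms by (induction I rule: finite_induct) (auto intro: has_sum_add)

lemma has_sum_power_sum:
  assumes "x \<in> lp_space p \<Gamma>"
  shows "((\<lambda>n. \<bar>x n\<bar> powr p) has_sum power_sum p \<Gamma> x) \<Gamma>"
  using assms by (auto simp: lp_space_def power_sum_def)

text \<open>
  Both sides are sums over the coordinates, so the inequality for reals applies coordinate by
  coordinate.
\<close>
lemma power_sum_negative_type:
  assumes "0 < p" "p < 2" "finite C" "C \<subseteq> lp_space p \<Gamma>"
  shows "(\<Sum>x\<in>C. \<Sum>y\<in>C. power_sum p \<Gamma> (x - y)) \<le> 2 * card C * (\<Sum>x\<in>C. power_sum p \<Gamma> x)"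
proof (rule has_sum_mono)
  show "((\<lambda>n. \<Sum>x\<in>C. \<Sum>y\<in>C. \<bar>(x - y) n\<bar> powr p) has_sum (\<Sum>x\<in>C. \<Sum>y\<in>C. power_sum p \<Gamma> (x - y))) \<Gamma>"
    using assms by (intro has_sum_finite_sum has_sum_power_sum lp_space_diff) auto
  show "((\<lambda>n. 2 * card C * (\<Sum>x\<in>C. \<bar>x n\<bar> powr p)) has_sum 2 * card C * (\<Sum>x\<in>C. power_sum p \<Gamma> x)) \<Gamma>"
    using assms by (intro has_sum_cmult_right has_sum_finite_sum has_sum_power_sum) auto
  show "(\<Sum>x\<in>C. \<Sum>y\<in>C. \<bar>(x - y) n\<bar> powr p) \<le> 2 * card C * (\<Sum>x\<in>C. \<bar>x n\<bar> powr p)" for n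
    using powr_negative_type[OF assms(1-3), of "\<lambda>x. x n"] by simp
qed

text \<open>
  Negative type compares the \<open>c (c - 1)\<close> mutual distances \<open>L\<close> with \<open>2 c\<^sup>2 r\<close>. The bound is
  of use when \<open>2 * r < L\<close>; a family of disjointly supported vectors shows that nothing holds for
  \<open>2 * r = L\<close>.
\<close>
lemma card_equidistant_on_sphere_le:
  fixes L :: real
  assumes p: "0 < p" "p < 2" and C: "finite C" "C \<subseteq> lp_space p \<Gamma>" and L: "0 \<le> L"
    and sphere: "\<And>x. x \<in> C \<Longrightarrow> power_sum p \<Gamma> x = r"
    and dist: "\<And>x y. x \<in> C \<Longrightarrow> y \<in> C \<Longrightarrow> x \<noteq> y \<Longrightarrow> power_sum p \<Gamma> (x - y) = L"
  shows "card C * (L - 2 * r) \<le> L"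
proof (cases "C = {}")
  case True
  with L show ?thesis by simp
next
  case False
  define c where "c = real (card C)"
  have c: "c > 0" using False C(1) by (simp add: c_def card_gt_0_iff)
  have "(\<Sum>y\<in>C. power_sum p \<Gamma> (x - y)) = (c - 1) * L" if "x \<in> C" for x
  proof -
    have "power_sum p \<Gamma> (x - x) = 0" unfolding power_sum_def by (intro infsum_0) simp
    then have "(\<Sum>y\<in>C. power_sum p \<Gamma> (x - y)) = (\<Sum>y\<in>C - {x}. power_sum p \<Gamma> (x - y))"
      using that C(1) by (simp add: sum.remove)
    also have "\<dots> = (\<Sum>y\<in>C - {x}. L)" using that dist by (intro sum.cong refl) auto
    also have "\<dots> = (c - 1) * L" using that C(1) c by (simp add: c_def of_nat_diff)
    finally show ?thesis .
  qed
  then have "c * ((c - 1) * L) \<le> c * (2 * c * r)"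
    using power_sum_negative_type[OF p C] sphere by (simp add: c_def mult_ac)
  then have "(c - 1) * L \<le> 2 * c * r" using c by simp
  then show ?thesis by (simp add: c_def algebra_simps)
qed

section \<open>Equilateral sets and bounds for extensions\<close>

lemma equilateral_lp_iff:
  assumes "0 < p"
  shows "equilateral (lp_space p \<Gamma>) (lp_norm p \<Gamma>) A \<longleftrightarrow>
    A \<subseteq> lp_space p \<Gamma> \<and> (\<exists>s>0. \<forall>x\<in>A. \<forall>y\<in>A. x \<noteq> y \<longrightarrow> power_sum p \<Gamma> (x - y) = s)"
    (is "?L \<longleftrightarrow> ?R")
proof
  assume ?L
  then obtain lam where lam: "lam > 0" "lam_equilateral (lp_space p \<Gamma>) (lp_norm p \<Gamma>) lam A"
    unfolding equilateral_def by blast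
  have "A \<subseteq> lp_space p \<Gamma>" "\<forall>x\<in>A. \<forall>y\<in>A. x \<noteq> y \<longrightarrow> power_sum p \<Gamma> (x - y) = lam powr p"
    using lam(2) unfolding lam_equilateral_def lp_norm_eq_iff[OF assms lam(1)] by simp_all
  moreover have "lam powr p > 0" using lam(1) by simp
  ultimately show ?R by (intro conjI exI[of _ "lam powr p"])
next
  assume ?R
  then obtain s where s: "A \<subseteq> lp_space p \<Gamma>" "s > 0"
      "\<forall>x\<in>A. \<forall>y\<in>A. x \<noteq> y \<longrightarrow> power_sum p \<Gamma> (x - y) = s"
    by blast
  define lam where "lam = s powr (1 / p)"
  have lam: "lam > 0" "lam powr p = s"
    using s(2) assms by (simp_all add: lam_def powr_powr)
  have "lam_equilateral (lp_space p \<Gamma>) (lp_norm p \<Gamma>) lam A"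
    unfolding lam_equilateral_def lp_norm_eq_iff[OF assms lam(1)] lam(2) using s by simp
  then show ?L using lam(1) unfolding equilateral_def by blast
qed

lemma equilateral_subset:
  "equilateral X N A \<Longrightarrow> B \<subseteq> A \<Longrightarrow> equilateral X N B"
  unfolding equilateral_def lam_equilateral_def by (meson subset_iff)

text \<open>
  A finite equilateral superset of \<open>A\<close> with the largest possible number of elements is maximal, since
  a proper extension, even an infinite one, would permit adding a single point.
\<close>
lemma min_equilateral_le:
  assumes "equilateral X N A" "finite A"
    and bound: "\<And>B. equilateral X N B \<Longrightarrow> finite B \<Longrightarrow> A \<subseteq> B \<Longrightarrow> card B \<le> K"
  shows "min_equilateral X N \<le> enat K"
proof -
  define P where "P B \<longleftrightarrow> equilateral X N B \<and> finite B \<and> A \<subseteq> B" for B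
  have "\<exists>B. P B \<and> (\<forall>C. P C \<longrightarrow> card C \<le> card B)"
    using assms by (intro ex_has_greatest_nat[of P A card "Suc K"]) (auto simp: P_def less_Suc_eq_le)
  then obtain B where B: "P B" "\<And>C. P C \<Longrightarrow> card C \<le> card B" by blast
  have "maximal_equilateral X N B"
    unfolding maximal_equilateral_def
  proof (intro conjI notI)
    show "equilateral X N B" using B by (simp add: P_def)
    assume "\<exists>A'. equilateral X N A' \<and> B \<subset> A'"
    then obtain A' b where "equilateral X N A'" "B \<subset> A'" "b \<in> A'" "b \<notin> B" by blast
    then have "equilateral X N (insert b B)"
      by (intro equilateral_subset[of X N A' "insert b B"]) auto
    then have "P (insert b B)" using B(1) by (auto simp: P_def)
    from B(2)[OF this] show False using B(1) \<open>b \<notin> B\<close> by (simp add: P_def)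
  qed
  then have "min_equilateral X N \<le> ecard B"
    unfolding min_equilateral_def by (intro INF_lower) simp
  also have "\<dots> \<le> enat K" using B(1) bound by (simp add: ecard_def P_def)
  finally show ?thesis .
qed

lemma power_sum_finite: "finite \<Gamma> \<Longrightarrow> power_sum p \<Gamma> x = (\<Sum>n\<in>\<Gamma>. \<bar>x n\<bar> powr p)"
  by (simp add: power_sum_def)

text \<open>
  Divide the cube of side \<open>2 * lam\<close> around one point of \<open>A\<close> into cells of side \<open>lam / m\<close>. All of
  \<open>A\<close> lies in the big cube. Two distinct points cannot share a cell, because over fewer than \<open>m\<close>
  coordinates their distance would be less than \<open>lam\<close>.
\<close>
lemma card_equilateral_finite_dim_le:
  assumes p: "1 \<le> p" and \<Gamma>: "finite \<Gamma>" "card \<Gamma> < m"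
    and A: "equilateral (lp_space p \<Gamma>) (lp_norm p \<Gamma>) A"
  shows "card A \<le> (2 * m + 1) ^ m"
proof (cases "A = {}")
  case False
  then obtain a where a: "a \<in> A" by blast
  from A obtain lam where lam: "lam > 0" and A0: "lam_equilateral (lp_space p \<Gamma>) (lp_norm p \<Gamma>) lam A"
    by (auto simp: equilateral_def)
  have ps: "(\<Sum>n\<in>\<Gamma>. \<bar>x n - y n\<bar> powr p) = lam powr p" if "x \<in> A" "y \<in> A" "x \<noteq> y" for x y
  proof -
    have "lp_norm p \<Gamma> (x - y) = lam"
      using A0 that unfolding lam_equilateral_def by blast
    then show ?thesis
      using lp_norm_eq_iff[of p lam \<Gamma> "x - y"] p lam \<Gamma>(1) by (simp add: power_sum_finite)
  qed
  have m: "real m \<ge> 1" using \<Gamma>(2) by simp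
  \<comment> \<open>the cell of \<open>x\<close>; coordinate \<open>lam\<close> itself falls into cell \<open>m\<close>, hence \<open>2 * m + 1\<close> values\<close>
  define F where "F x = (\<lambda>n\<in>\<Gamma>. \<lfloor>m * ((x n - a n) / lam)\<rfloor>)" for x
  have le: "\<bar>x n - a n\<bar> \<le> lam" if "x \<in> A" "n \<in> \<Gamma>" for x n
  proof (cases "x = a")
    case False
    have "\<bar>x n - a n\<bar> powr p \<le> (\<Sum>n\<in>\<Gamma>. \<bar>x n - a n\<bar> powr p)"
      using \<Gamma>(1) that by (intro member_le_sum) auto
    then have "\<bar>x n - a n\<bar> powr p \<le> lam powr p" using ps[of x a] False that a by simp
    then show ?thesis using p lam powr_less_mono2[of p lam "\<bar>x n - a n\<bar>"] by linarith
  qed (use lam in auto)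
  have "inj_on F A"
  proof (rule inj_onI, rule ccontr)
    fix x y assume xy: "x \<in> A" "y \<in> A" "F x = F y" "x \<noteq> y"
    have "\<bar>x n - y n\<bar> powr p \<le> lam powr p / m" if n: "n \<in> \<Gamma>" for n
    proof -
      have "\<lfloor>m * ((x n - a n) / lam)\<rfloor> = \<lfloor>m * ((y n - a n) / lam)\<rfloor>"
        using fun_cong[OF xy(3), of n] n by (simp add: F_def)
      then have "\<bar>m * ((x n - a n) / lam) - m * ((y n - a n) / lam)\<bar> \<le> 1" by linarith
      also have "m * ((x n - a n) / lam) - m * ((y n - a n) / lam) = (m / lam) * (x n - y n)"
        by (simp add: algebra_simps diff_divide_distrib)
      finally have "\<bar>x n - y n\<bar> \<le> lam / m"
        using lam m unfolding abs_mult by (simp add: field_simps)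
      then have "\<bar>x n - y n\<bar> powr p \<le> (lam / m) powr p"
        using p by (intro powr_mono2) auto
      also have "\<dots> = lam powr p / m powr p" using lam m by (simp add: powr_divide)
      also have "\<dots> \<le> lam powr p / m"
        using m p powr_mono[of 1 p m] by (intro divide_left_mono) auto
      finally show ?thesis .
    qed
    then have "lam powr p \<le> (\<Sum>n\<in>\<Gamma>. lam powr p / m)"
      using ps[OF xy(1,2,4)] sum_mono[of \<Gamma> "\<lambda>n. \<bar>x n - y n\<bar> powr p" "\<lambda>n. lam powr p / m"] by simp
    also have "\<dots> = lam powr p * (card \<Gamma> / m)" by simp
    also have "\<dots> < lam powr p * 1"
      using lam m \<Gamma>(2) by (intro mult_strict_left_mono) auto
    finally show False by simp
  qed
  moreover have "F ` A \<subseteq> (\<Pi>\<^sub>E n\<in>\<Gamma>. {- int m..int m})"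
  proof -
    have "\<lfloor>m * ((x n - a n) / lam)\<rfloor> \<in> {- int m..int m}" if "x \<in> A" "n \<in> \<Gamma>" for x n
    proof -
      have "\<bar>(x n - a n) / lam\<bar> \<le> 1" using le[OF that] lam by simp
      then have "\<bar>m * ((x n - a n) / lam)\<bar> \<le> m"
        using mult_left_mono[of "\<bar>(x n - a n) / lam\<bar>" 1 "real m"] m by (simp add: abs_mult)
      moreover have "\<lfloor>z\<rfloor> \<in> {- int m..int m}" if "\<bar>z\<bar> \<le> m" for z :: real
        using that by (simp add: le_floor_iff floor_le_iff abs_le_iff)
      ultimately show ?thesis by blast
    qed
    then show ?thesis by (auto simp: F_def)
  qed
  ultimately have "card A \<le> card (\<Pi>\<^sub>E n\<in>\<Gamma>. {- int m..int m})"
    using \<Gamma>(1) by (metis card_inj_on_le finite_PiE finite_atLeastAtMost_int)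
  also have "\<dots> = (2 * m + 1) ^ card \<Gamma>"
    using \<Gamma>(1) by (simp add: card_PiE nat_add_distrib nat_mult_distrib)
  also have "\<dots> \<le> (2 * m + 1) ^ m" using \<Gamma>(2) by (intro power_increasing) auto
  finally show ?thesis .
qed simp

section \<open>Hadamard matrices\<close>

text \<open>
  Symmetry makes the rows orthogonal along with the columns, and the constant first column says that
  every other column has sum zero. The conditions on signs and symmetry range over all indices to spare
  side conditions.
\<close>
definition normalized_hadamard :: "nat \<Rightarrow> (nat \<Rightarrow> nat \<Rightarrow> real) \<Rightarrow> bool" where
  "normalized_hadamard n H \<longleftrightarrow>
     (\<forall>i j. H i j \<in> {1, - 1}) \<and> (\<forall>i j. H i j = H j i) \<and> (\<forall>i. H i 0 = 1) \<and>
     (\<forall>j<n. \<forall>l<n. j \<noteq> l \<longrightarrow> (\<Sum>i<n. H i j * H i l) = 0)"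

lemma normalized_hadamardD:
  assumes "normalized_hadamard n H"
  shows "H i j = 1 \<or> H i j = - 1" "H i j = H j i" "H i 0 = 1"
    "j < n \<Longrightarrow> l < n \<Longrightarrow> j \<noteq> l \<Longrightarrow> (\<Sum>i<n. H i j * H i l) = 0"
  using assms unfolding normalized_hadamard_def by blast+

text \<open>
  Sylvester's construction: four copies of \<open>H\<close>, the last one negated, form a Hadamard matrix of twice
  the order.
\<close>
lemma normalized_hadamard_exists: "\<exists>H. normalized_hadamard (2 ^ k) H"
proof (induction k)
  case 0
  show ?case by (rule exI[of _ "\<lambda>i j. 1"]) (simp add: normalized_hadamard_def)
next
  case (Suc k)
  then obtain H where had: "normalized_hadamard (2 ^ k) H" ..
  note H = normalized_hadamardD[OF had]
  define n :: nat where "n = 2 ^ k"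
  define G where "G i j = (if n \<le> i \<and> n \<le> j then - 1 else 1) * H (i mod n) (j mod n)" for i j
  have n: "n > 0" by (simp add: n_def)
  have split: "(\<Sum>i<2^Suc k. f i) = (\<Sum>i<n. f i) + (\<Sum>i<n. f (n + i))" for f :: "nat \<Rightarrow> real"
  proof -
    have "(2::nat) ^ Suc k = n + n" by (simp add: n_def)
    then show ?thesis
      using sum.atLeastLessThan_concat[of 0 n "n + n" f] sum.shift_bounds_nat_ivl[of f 0 n n]
      by (simp add: lessThan_atLeast0 add.commute)
  qed
  have o: "(\<Sum>i<2^Suc k. G i j * G i l) = 0" if jl: "j < 2^Suc k" "l < 2^Suc k" "j \<noteq> l" for j l
  proof -
    define c where "c = (\<Sum>i<n. H i (j mod n) * H i (l mod n))"
    define e :: "nat \<Rightarrow> real" where "e j = (if n \<le> j then - 1 else 1)" for j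
    have "(\<Sum>i<2^Suc k. G i j * G i l) = c + e j * e l * c"
      unfolding split c_def sum_distrib_left by (auto simp: G_def e_def intro!: sum.cong)
    moreover have "c = 0 \<or> e j * e l = - 1"
    proof (cases "j mod n = l mod n")
      case True
      have m: "i mod n = (if n \<le> i then i - n else i)" if "i < 2 ^ Suc k" for i
        using that by (simp add: n_def le_mod_geq)
      have "(n \<le> j) \<noteq> (n \<le> l)"
        using True jl(3) unfolding m[OF jl(1)] m[OF jl(2)] by (auto split: if_splits)
      then show ?thesis by (auto simp: e_def)
    next
      case False
      then have "c = 0" using H(4)[of "j mod n" "l mod n"] n by (simp add: c_def n_def)
      then show ?thesis ..
    qed
    ultimately show ?thesis by auto
  qed
  show ?case
    unfolding normalized_hadamard_def
  proof (intro exI[of _ G] conjI allI impI)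
    fix i j
    show "G i j \<in> {1, - 1}" using H(1)[of "i mod n" "j mod n"] by (auto simp: G_def)
    show "G i j = G j i" using H(2)[of "i mod n" "j mod n"] by (simp add: G_def conj_commute)
    show "G i 0 = 1" using H(3) n by (simp add: G_def)
  qed (rule o)
qed

section \<open>The simplex of Hadamard points\<close>

lemma power_sum_split:
  assumes "finite E" "E \<subseteq> \<Gamma>" "x \<in> lp_space p \<Gamma>"
  shows "power_sum p \<Gamma> x = (\<Sum>m\<in>E. \<bar>x m\<bar> powr p) + power_sum p (\<Gamma> - E) x"
proof -
  have "(\<lambda>n. \<bar>x n\<bar> powr p) summable_on \<Gamma> - E"
    using assms(3) by (auto simp: lp_space_def intro: summable_on_subset_banach)
  then have "infsum (\<lambda>n. \<bar>x n\<bar> powr p) (E \<union> (\<Gamma> - E)) =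
      infsum (\<lambda>n. \<bar>x n\<bar> powr p) E + infsum (\<lambda>n. \<bar>x n\<bar> powr p) (\<Gamma> - E)"
    using assms(1) by (intro infsum_Un_disjoint) auto
  moreover have "E \<union> (\<Gamma> - E) = \<Gamma>" using assms(2) by auto
  ultimately show ?thesis using assms(1) by (simp add: power_sum_def)
qed

text \<open>
  Row \<open>i\<close> of the matrix, placed on the coordinates \<open>e 1, ..., e (n - 1)\<close>. Column \<open>0\<close> is left out:
  being constant, it adds nothing to the distances, and \<open>n\<close> rows on \<open>n - 1\<close> coordinates have only one
  point equidistant from all of them.
\<close>
definition hadamard_point :: "(nat \<Rightarrow> nat \<Rightarrow> real) \<Rightarrow> nat \<Rightarrow> (nat \<Rightarrow> 'a) \<Rightarrow> nat \<Rightarrow> 'a \<Rightarrow> real" where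
  "hadamard_point H n e i m = (if m \<in> e ` {1..<n} then H i (inv_into {1..<n} e m) else 0)"

lemma hadamard_point_at:
  assumes "inj_on e {1..<n}" "j \<in> {1..<n}"
  shows "hadamard_point H n e i (e j) = H i j"
  using assms by (simp add: hadamard_point_def)

lemma hadamard_point_in_lp:
  assumes "e ` {1..<n} \<subseteq> \<Gamma>"
  shows "hadamard_point H n e i \<in> lp_space p \<Gamma>"
proof -
  have "(\<lambda>m. \<bar>hadamard_point H n e i m\<bar> powr p) summable_on \<Gamma> \<longleftrightarrow>
        (\<lambda>m. \<bar>hadamard_point H n e i m\<bar> powr p) summable_on e ` {1..<n}"
    using assms by (intro summable_on_cong_neutral) (auto simp: hadamard_point_def)
  then show ?thesis using assms by (auto simp: lp_space_def hadamard_point_def)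
qed

lemma power_sum_diff_hadamard_point:
  assumes "0 < p" "inj_on e {1..<n}" "e ` {1..<n} \<subseteq> \<Gamma>" "y \<in> lp_space p \<Gamma>"
  shows "power_sum p \<Gamma> (y - hadamard_point H n e i) =
     (\<Sum>j=1..<n. \<bar>y (e j) - H i j\<bar> powr p) + power_sum p (\<Gamma> - e ` {1..<n}) y"
proof -
  have "power_sum p (\<Gamma> - e ` {1..<n}) (y - hadamard_point H n e i) = power_sum p (\<Gamma> - e ` {1..<n}) y"
    unfolding power_sum_def by (intro infsum_cong) (simp add: hadamard_point_def)
  moreover have "(\<Sum>m\<in>e ` {1..<n}. \<bar>(y - hadamard_point H n e i) m\<bar> powr p) =
      (\<Sum>j=1..<n. \<bar>y (e j) - H i j\<bar> powr p)"
    using assms(2) by (subst sum.reindex) (auto intro!: sum.cong simp: hadamard_point_at)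
  ultimately show ?thesis
    using power_sum_split[of "e ` {1..<n}" \<Gamma> "y - hadamard_point H n e i" p] assms
      lp_space_diff[OF assms(1,4) hadamard_point_in_lp[OF assms(3)]] by simp
qed

text \<open>
  Two orthogonal rows of signs differ in exactly \<open>n / 2\<close> places, none of them in the constant
  column, and each difference contributes \<open>2 powr p\<close>.
\<close>
lemma power_sum_hadamard_points_diff:
  assumes "0 < p" and H: "normalized_hadamard n H" and e: "inj_on e {1..<n}" "e ` {1..<n} \<subseteq> \<Gamma>"
    and ik: "i < n" "k < n" "i \<noteq> k"
  shows "power_sum p \<Gamma> (hadamard_point H n e i - hadamard_point H n e k) = 2 powr p * n / 2"
proof -
  note pm = normalized_hadamardD(1)[OF H]
  have "(\<Sum>j<n. H j i * H j k) = 0" using normalized_hadamardD(4)[OF H] ik by simp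
  also have "(\<Sum>j<n. H j i * H j k) = (\<Sum>j<n. H i j * H k j)"
    by (intro sum.cong refl arg_cong2[of _ _ _ _ "(*)"] normalized_hadamardD(2)[OF H])
  finally have orth: "(\<Sum>j<n. H i j * H k j) = 0" .
  have "power_sum p (\<Gamma> - e ` {1..<n}) (hadamard_point H n e i) = 0"
    unfolding power_sum_def by (intro infsum_0) (simp add: hadamard_point_def)
  then have "power_sum p \<Gamma> (hadamard_point H n e i - hadamard_point H n e k) =
      (\<Sum>j=1..<n. \<bar>H i j - H k j\<bar> powr p)"
    using e by (subst power_sum_diff_hadamard_point)
      (auto simp: assms(1) hadamard_point_in_lp hadamard_point_at intro!: sum.cong)
  also have "\<dots> = (\<Sum>j=1..<n. 2 powr p / 2 * (1 - H i j * H k j))"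
  proof (intro sum.cong refl)
    fix j show "\<bar>H i j - H k j\<bar> powr p = 2 powr p / 2 * (1 - H i j * H k j)"
      using pm[of i j] pm[of k j] by (elim disjE) auto
  qed
  also have "\<dots> = (\<Sum>j<n. 2 powr p / 2 * (1 - H i j * H k j))"
  proof (rule sum.mono_neutral_left)
    show "\<forall>j\<in>{..<n} - {1..<n}. 2 powr p / 2 * (1 - H i j * H k j) = 0"
    proof
      fix j assume "j \<in> {..<n} - {1..<n}"
      then have "j = 0" by auto
      then show "2 powr p / 2 * (1 - H i j * H k j) = 0" by (simp add: normalized_hadamardD(3)[OF H])
    qed
  qed auto
  also have "\<dots> = 2 powr p / 2 * (real n - (\<Sum>j<n. H i j * H k j))"
    by (simp only: sum_distrib_left[symmetric] sum_subtractf) simp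
  finally show ?thesis using orth by simp
qed

text \<open>
  For a sign \<open>s\<close>, the term \<open>\<bar>y - s\<bar> powr p\<close> is an affine function \<open>A - s * B\<close> of \<open>s\<close>. Equal
  distances therefore say that the combination of the columns with coefficients \<open>B j\<close> is a constant
  vector. As column \<open>k\<close> is orthogonal to the constant vector and to the other columns, \<open>B k = 0\<close>.
  This means that \<open>y (e k)\<close> is equally far from \<open>1\<close> and \<open>- 1\<close>, so it is \<open>0\<close>. Each of the \<open>n - 1\<close>
  coordinates then contributes \<open>1\<close> to the distance from a row and \<open>0\<close> to the norm of \<open>y\<close>.
\<close>
lemma power_sum_of_equidistant:
  assumes "0 < p" and H: "normalized_hadamard n H" and e: "inj_on e {1..<n}" "e ` {1..<n} \<subseteq> \<Gamma>"
    and y: "y \<in> lp_space p \<Gamma>" and n: "0 < n"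
    and d: "\<And>i. i < n \<Longrightarrow> power_sum p \<Gamma> (y - hadamard_point H n e i) = L"
  shows "power_sum p \<Gamma> y = L - (real n - 1)"
proof -
  note pm = normalized_hadamardD(1)[OF H]
  define A B where "A j = (\<bar>y (e j) - 1\<bar> powr p + \<bar>y (e j) + 1\<bar> powr p) / 2"
    and "B j = (\<bar>y (e j) + 1\<bar> powr p - \<bar>y (e j) - 1\<bar> powr p) / 2" for j
  define R where "R = power_sum p (\<Gamma> - e ` {1..<n}) y"
  have AB: "\<bar>y (e j) - H i j\<bar> powr p = A j - H i j * B j" for i j
    using pm[of i j] by (elim disjE) (simp_all add: A_def B_def field_simps)
  define c where "c = (\<Sum>j=1..<n. A j) + R - L"
  have c: "(\<Sum>j=1..<n. H i j * B j) = c" if "i < n" for i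
    using d[OF that] power_sum_diff_hadamard_point[OF assms(1) e y, of H i]
    by (simp add: AB sum_subtractf c_def R_def)
  have y0: "y (e k) = 0" if k: "k \<in> {1..<n}" for k
  proof -
    note H0 = normalized_hadamardD(3)[OF H]
    have orth: "(\<Sum>i<n. H i j * H i k) = (if j = k then n else 0)" if "j < n" for j
    proof (cases "j = k")
      case True
      have "H i k * H i k = 1" for i using pm[of i k] by auto
      then show ?thesis using True by simp
    next
      case False
      then show ?thesis using normalized_hadamardD(4)[OF H that, of k] k by simp
    qed
    \<comment> \<open>pair the constant vector of the sums \<open>\<Sum>j. H i j * B j\<close> with column \<open>k\<close>\<close>
    have "n * B k = (\<Sum>j=1..<n. if j = k then n * B j else 0)"
      using k by simp
    also have "\<dots> = (\<Sum>j=1..<n. (\<Sum>i<n. H i j * H i k) * B j)"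
      by (intro sum.cong refl) (simp add: orth)
    also have "\<dots> = (\<Sum>i<n. H i k * (\<Sum>j=1..<n. H i j * B j))"
      unfolding sum_distrib_left sum_distrib_right by (subst sum.swap) (simp add: mult_ac)
    also have "\<dots> = (\<Sum>i<n. H i 0 * H i k) * c"
      unfolding sum_distrib_right by (intro sum.cong refl) (use c in \<open>auto simp: H0\<close>)
    also have "\<dots> = 0" using orth[of 0] k n by simp
    finally have "\<bar>y (e k) + 1\<bar> powr p = \<bar>y (e k) - 1\<bar> powr p" using n by (simp add: B_def)
    then have "\<bar>y (e k) + 1\<bar> = \<bar>y (e k) - 1\<bar>"
      using powr_less_mono2[OF assms(1), of "\<bar>y (e k) + 1\<bar>" "\<bar>y (e k) - 1\<bar>"]
        powr_less_mono2[OF assms(1), of "\<bar>y (e k) - 1\<bar>" "\<bar>y (e k) + 1\<bar>"] by linarith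
    then show ?thesis by linarith
  qed
  have "power_sum p \<Gamma> y = (\<Sum>m\<in>e ` {1..<n}. \<bar>y m\<bar> powr p) + R"
    unfolding R_def using e y by (intro power_sum_split) auto
  also have "(\<Sum>m\<in>e ` {1..<n}. \<bar>y m\<bar> powr p) = 0" by (intro sum.neutral) (auto simp: y0)
  finally have "power_sum p \<Gamma> y = R" by simp
  moreover have "L = (\<Sum>j=1..<n. 1) + R"
  proof -
    have "L = (\<Sum>j=1..<n. \<bar>y (e j) - H 0 j\<bar> powr p) + R"
      using d[OF n] power_sum_diff_hadamard_point[OF assms(1) e y, of H 0] by (simp add: R_def)
    also have "(\<Sum>j=1..<n. \<bar>y (e j) - H 0 j\<bar> powr p) = (\<Sum>j=1..<n. 1)"
    proof (intro sum.cong refl)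
      fix j assume "j \<in> {1..<n}"
      then show "\<bar>y (e j) - H 0 j\<bar> powr p = 1" using y0[of j] pm[of 0 j] by auto
    qed
    finally show ?thesis .
  qed
  ultimately show ?thesis using n by simp
qed

text \<open>
  The points that extend the Hadamard points to an equilateral set all lie on the sphere of
  \<open>p\<close>-th power radius \<open>L - (n - 1)\<close>, and the hypothesis on \<open>n\<close> says that this is less than
  \<open>L / 2\<close>.
\<close>
lemma m_lp_le_of_hadamard:
  assumes p: "1 \<le> p" "p < 2" and H: "normalized_hadamard n H"
    and e: "inj_on e {1..<n}" "e ` {1..<n} \<subseteq> \<Gamma>"
    and n: "2 \<le> n" "2 powr p * n / 2 < 2 * (real n - 1)"
  shows "m_lp p \<Gamma> \<le>
    enat (n + nat \<lceil>(2 powr p * n / 2) / (2 * (real n - 1) - 2 powr p * n / 2)\<rceil>)"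
proof -
  define a where "a = hadamard_point H n e"
  define A where "A = a ` {..<n}"
  define L where "L = 2 powr p * n / 2"
  have p0: "0 < p" using p by simp
  have L: "L > 0" using n by (simp add: L_def)
  have aL: "power_sum p \<Gamma> (a i - a k) = L" if "i < n" "k < n" "i \<noteq> k" for i k
    unfolding a_def L_def by (rule power_sum_hadamard_points_diff[OF p0 H e that])
  have a01: "a 0 \<in> A" "a 1 \<in> A" "a 0 \<noteq> a 1"
  proof -
    show "a 0 \<in> A" "a 1 \<in> A" using n by (auto simp: A_def)
    have "power_sum p \<Gamma> (a 0 - a 0) = 0" unfolding power_sum_def by (intro infsum_0) simp
    then show "a 0 \<noteq> a 1" using aL[of 0 1] n L by auto
  qed
  have A: "equilateral (lp_space p \<Gamma>) (lp_norm p \<Gamma>) A"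
    unfolding equilateral_lp_iff[OF p0]
  proof (intro conjI exI[of _ L] ballI impI L)
    show "A \<subseteq> lp_space p \<Gamma>" unfolding A_def a_def using hadamard_point_in_lp[OF e(2)] by blast
    fix x y assume "x \<in> A" "y \<in> A" "x \<noteq> y"
    then obtain i k where "x = a i" "y = a k" "i < n" "k < n" "i \<noteq> k" unfolding A_def by blast
    then show "power_sum p \<Gamma> (x - y) = L" using aL by simp
  qed
  show ?thesis
    unfolding m_lp_def
  proof (rule min_equilateral_le[OF A])
    show "finite A" by (simp add: A_def)
    fix B assume B: "equilateral (lp_space p \<Gamma>) (lp_norm p \<Gamma>) B" "finite B" "A \<subseteq> B"
    from B(1) obtain s where Bs: "B \<subseteq> lp_space p \<Gamma>"
        "\<forall>x\<in>B. \<forall>y\<in>B. x \<noteq> y \<longrightarrow> power_sum p \<Gamma> (x - y) = s"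
      unfolding equilateral_lp_iff[OF p0] by blast
    have "a 0 \<in> B" "a 1 \<in> B" using a01 B(3) by auto
    then have "power_sum p \<Gamma> (a 0 - a 1) = s" using Bs(2) a01(3) by blast
    \<comment> \<open>\<open>B\<close> contains two Hadamard points, so its common distance is theirs\<close>
    then have "s = L" using aL[of 0 1] n by simp
    then have BL: "power_sum p \<Gamma> (x - y) = L" if "x \<in> B" "y \<in> B" "x \<noteq> y" for x y
      using Bs(2) that by blast
    define C where "C = B - A"
    have C: "finite C" "C \<subseteq> lp_space p \<Gamma>" using B(2) Bs(1) by (auto simp: C_def)
    have sphere: "power_sum p \<Gamma> y = L - (real n - 1)" if "y \<in> C" for y
    proof (rule power_sum_of_equidistant[OF p0 H e])
      show "y \<in> lp_space p \<Gamma>" using that C by blast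
      show "0 < n" using n by simp
      fix i assume "i < n"
      then have "a i \<in> A" by (simp add: A_def)
      then show "power_sum p \<Gamma> (y - hadamard_point H n e i) = L"
        using BL[of y "a i"] that B(3) unfolding a_def[symmetric] C_def by auto
    qed
    have "card C * (L - 2 * (L - (real n - 1))) \<le> L"
      using L by (intro card_equidistant_on_sphere_le[OF p0 p(2) C] sphere BL) (auto simp: C_def)
    moreover have D: "L - 2 * (L - (real n - 1)) = 2 * (real n - 1) - L" by simp
    ultimately have "card C \<le> L / (2 * (real n - 1) - L)"
      using n(2) unfolding L_def[symmetric] by (simp add: pos_le_divide_eq)
    then have cC: "card C \<le> nat \<lceil>L / (2 * (real n - 1) - L)\<rceil>" by linarith
    have "card A \<le> n" unfolding A_def using card_image_le[of "{..<n}" a] by simp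
    moreover have "card B \<le> card A + card C"
      unfolding C_def using B(2,3) by (simp add: card_Diff_subset finite_subset)
    ultimately show "card B \<le> n + nat \<lceil>(2 powr p * n / 2) / (2 * (real n - 1) - 2 powr p * n / 2)\<rceil>"
      using cC unfolding L_def by linarith
  qed
qed

section \<open>A bound depending only on the exponent\<close>

text \<open>
  The order \<open>n\<close> depends on \<open>p\<close> alone, and so do the bounds for \<open>\<Gamma>\<close> with fewer than \<open>n\<close> and
  with at least \<open>n\<close> elements.
\<close>
lemma m_lp_bounded:
  assumes p: "1 \<le> p" "p < 2"
  shows "\<exists>K. \<forall>\<Gamma>::'a set. m_lp p \<Gamma> \<le> enat K"
proof -
  have "2 powr p < 2 powr 2" using p by (intro powr_less_mono) auto
  then have q: "2 powr p < 4" by simp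
  \<comment> \<open>\<open>2 powr p * n / 2 < 2 * (n - 1)\<close> amounts to \<open>4 / (4 - 2 powr p) < n\<close>\<close>
  obtain k where k: "4 / (4 - 2 powr p) < 2 ^ k"
    using real_arch_pow[of 2 "4 / (4 - 2 powr p)"] by auto
  define n :: nat where "n = 2 ^ k"
  have "4 < n * (4 - 2 powr p)"
    using k q by (simp add: n_def field_simps)
  then have n: "2 powr p * n / 2 < 2 * (real n - 1)" by (simp add: algebra_simps)
  have "0 < 2 powr p * n / 2" by (simp add: n_def)
  with n have "1 < n" by simp
  obtain H where H: "normalized_hadamard n H"
    using normalized_hadamard_exists unfolding n_def by blast
  define K1 where "K1 = n + nat \<lceil>(2 powr p * n / 2) / (2 * (real n - 1) - 2 powr p * n / 2)\<rceil>"
  define K2 where "K2 = (2 * n + 1) ^ n"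
  have "m_lp p \<Gamma> \<le> enat (max K1 K2)" for \<Gamma> :: "'a set"
  proof (cases "finite \<Gamma> \<and> card \<Gamma> < n")
    case True
    have "m_lp p \<Gamma> \<le> enat K2"
      unfolding m_lp_def
    proof (rule min_equilateral_le[of _ _ "{}"])
      show "equilateral (lp_space p \<Gamma>) (lp_norm p \<Gamma>) {}"
        unfolding equilateral_def lam_equilateral_def by (auto intro: exI[of _ 1])
    qed (use True card_equilateral_finite_dim_le[OF p(1)] in \<open>auto simp: K2_def\<close>)
    then show ?thesis by (rule order_trans) simp
  next
    case False
    have "\<exists>D\<subseteq>\<Gamma>. finite D \<and> card D = n - 1"
    proof (cases "finite \<Gamma>")
      case True
      then show ?thesis using False obtain_subset_with_card_n[of "n - 1" \<Gamma>]
        by (metis diff_le_self finite_subset le_trans not_less)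
    next
      case False
      then show ?thesis using infinite_arbitrarily_large by blast
    qed
    then obtain D where D: "D \<subseteq> \<Gamma>" "finite D" "card D = card {1..<n}" by auto
    then obtain e where "bij_betw e {1..<n} D"
      using finite_same_card_bij[of "{1..<n}" D] by auto
    then have "inj_on e {1..<n}" "e ` {1..<n} \<subseteq> \<Gamma>" using D(1) by (auto simp: bij_betw_def)
    from m_lp_le_of_hadamard[OF p H this _ n] \<open>1 < n\<close>
    have "m_lp p \<Gamma> \<le> enat K1" by (simp add: K1_def)
    then show ?thesis by (rule order_trans) simp
  qed
  then show ?thesis by blast
qed

section \<open>Changing the index set\<close>

definition push_forward :: "('b \<Rightarrow> 'a) \<Rightarrow> 'b set \<Rightarrow> ('b \<Rightarrow> real) \<Rightarrow> 'a \<Rightarrow> real" where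
  "push_forward f S x n = (if n \<in> f ` S then x (inv_into S f n) else 0)"

lemma push_forward_at: "inj_on f S \<Longrightarrow> s \<in> S \<Longrightarrow> push_forward f S x (f s) = x s"
  by (simp add: push_forward_def)

lemma push_forward_diff: "push_forward f S x - push_forward f S y = push_forward f S (x - y)"
  by (auto simp: push_forward_def)

lemma has_sum_push_forward:
  assumes "inj_on f S" "f ` S \<subseteq> \<Gamma>" "S \<subseteq> \<Gamma>'" "\<And>n. n \<notin> S \<Longrightarrow> x n = 0"
  shows "((\<lambda>n. \<bar>push_forward f S x n\<bar> powr p) has_sum s) \<Gamma> \<longleftrightarrow> ((\<lambda>n. \<bar>x n\<bar> powr p) has_sum s) \<Gamma>'"
proof -
  have "((\<lambda>n. \<bar>push_forward f S x n\<bar> powr p) has_sum s) \<Gamma> \<longleftrightarrow>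
        ((\<lambda>n. \<bar>push_forward f S x n\<bar> powr p) has_sum s) (f ` S)"
    using assms(2) by (intro has_sum_cong_neutral) (auto simp: push_forward_def)
  also have "\<dots> \<longleftrightarrow> ((\<lambda>n. \<bar>x n\<bar> powr p) has_sum s) S"
    using assms(1) by (subst has_sum_reindex) (auto simp: push_forward_at o_def intro!: has_sum_cong)
  also have "\<dots> \<longleftrightarrow> ((\<lambda>n. \<bar>x n\<bar> powr p) has_sum s) \<Gamma>'"
    using assms(3,4) by (intro has_sum_cong_neutral) auto
  finally show ?thesis .
qed

lemma equilateral_push_forward:
  assumes p: "0 < p" and f: "inj_on f S" "f ` S \<subseteq> \<Gamma>" "S \<subseteq> \<Gamma>'"
    and supp: "\<And>x n. x \<in> A \<Longrightarrow> n \<notin> S \<Longrightarrow> x n = 0"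
    and A: "equilateral (lp_space p \<Gamma>') (lp_norm p \<Gamma>') A"
  shows "equilateral (lp_space p \<Gamma>) (lp_norm p \<Gamma>) (push_forward f S ` A)"
proof -
  from A obtain s where s: "A \<subseteq> lp_space p \<Gamma>'" "s > 0"
      "\<forall>x\<in>A. \<forall>y\<in>A. x \<noteq> y \<longrightarrow> power_sum p \<Gamma>' (x - y) = s"
    unfolding equilateral_lp_iff[OF p] by blast
  note hs = has_sum_push_forward[OF f, where p = p]
  show ?thesis
    unfolding equilateral_lp_iff[OF p]
  proof (intro conjI exI[of _ s] ballI impI s(2) subsetI)
    fix z assume "z \<in> push_forward f S ` A"
    then obtain x where x: "z = push_forward f S x" "x \<in> A" by blast
    have "((\<lambda>n. \<bar>z n\<bar> powr p) has_sum power_sum p \<Gamma>' x) \<Gamma>"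
      unfolding x(1) using x(2) s(1) supp by (intro hs[THEN iffD2] has_sum_power_sum) auto
    then show "z \<in> lp_space p \<Gamma>"
      using f(2) x(1) by (auto simp: lp_space_def push_forward_def summable_on_def)
  next
    fix z w assume "z \<in> push_forward f S ` A" "w \<in> push_forward f S ` A" "z \<noteq> w"
    then obtain x y where x: "z = push_forward f S x" "x \<in> A" "w = push_forward f S y" "y \<in> A" "x \<noteq> y"
      by blast
    have "(x - y) n = 0" if "n \<notin> S" for n
      using supp[OF x(2) that] supp[OF x(4) that] by simp
    then have "((\<lambda>n. \<bar>push_forward f S (x - y) n\<bar> powr p) has_sum power_sum p \<Gamma>' (x - y)) \<Gamma>"
      using x s(1) p by (intro hs[THEN iffD2] has_sum_power_sum lp_space_diff) auto
    then have "power_sum p \<Gamma> (z - w) = power_sum p \<Gamma>' (x - y)"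
      unfolding x(1,3) push_forward_diff unfolding power_sum_def[of p \<Gamma>] by (rule infsumI)
    then show "power_sum p \<Gamma> (z - w) = s" using x s(3) by auto
  qed
qed

lemma push_forward_push_forward:
  assumes f: "inj_on f S" and g: "inj_on g T" "f ` S \<subseteq> T" "\<And>s. s \<in> S \<Longrightarrow> g (f s) = s"
    and x: "\<And>n. n \<notin> S \<Longrightarrow> x n = 0"
  shows "push_forward g T (push_forward f S x) = x"
proof
  fix n
  show "push_forward g T (push_forward f S x) n = x n"
  proof (cases "n \<in> g ` T")
    case True
    then obtain t where t: "t \<in> T" "n = g t" by blast
    have e: "push_forward g T (push_forward f S x) n = push_forward f S x t"
      using t g(1) by (simp add: push_forward_at)
    show ?thesis
    proof (cases "n \<in> S")
      case True
      then have "g (f n) = g t" using g(3) t by simp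
      then have "f n = t" using g(1,2) True t(1) by (auto dest: inj_onD)
      then show ?thesis using e True push_forward_at[OF f True, of x] by simp
    next
      case False
      then have "t \<notin> f ` S" using g(3) t(2) by auto
      then show ?thesis using e x[OF False] by (simp add: push_forward_def)
    qed
  next
    case False
    then have "n \<notin> S" using g(2,3) by (metis image_eqI image_subset_iff)
    then show ?thesis using False x by (simp add: push_forward_def)
  qed
qed

text \<open>
  What is needed to move an equilateral set supported in \<open>S\<close> from \<open>\<Gamma>'\<close> to \<open>\<Gamma>\<close> and to move a
  potential extension, whose support is a countable set \<open>T\<close>, back again. The inverse map is chosen
  after \<open>T\<close>, because an uncountable \<open>\<Gamma>\<close> need not embed into \<open>\<Gamma>'\<close> as a whole.
\<close>
definition countably_invertible :: "('b \<Rightarrow> 'a) \<Rightarrow> 'b set \<Rightarrow> 'b set \<Rightarrow> 'a set \<Rightarrow> bool" where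
  "countably_invertible f S \<Gamma>' \<Gamma> \<longleftrightarrow>
     countable S \<and> S \<subseteq> \<Gamma>' \<and> inj_on f S \<and> f ` S \<subseteq> \<Gamma> \<and>
     (\<forall>T. countable T \<and> f ` S \<subseteq> T \<and> T \<subseteq> \<Gamma> \<longrightarrow>
        (\<exists>g. inj_on g T \<and> g ` T \<subseteq> \<Gamma>' \<and> (\<forall>s\<in>S. g (f s) = s)))"

text \<open>
  A vector \<open>b\<close> extending the image would have countable support, so it could be carried back by
  some \<open>g\<close> that undoes \<open>f\<close> on \<open>S\<close>, and it would extend \<open>A\<close> there. It cannot land in \<open>A\<close> itself,
  since \<open>b\<close> would then be the transport of an element of \<open>A\<close>.
\<close>
lemma maximal_equilateral_push_forward:
  assumes p: "0 < p" and inv: "countably_invertible f S \<Gamma>' \<Gamma>"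
    and supp: "\<And>x n. x \<in> A \<Longrightarrow> n \<notin> S \<Longrightarrow> x n = 0"
    and A: "maximal_equilateral (lp_space p \<Gamma>') (lp_norm p \<Gamma>') A"
  shows "maximal_equilateral (lp_space p \<Gamma>) (lp_norm p \<Gamma>) (push_forward f S ` A)"
  unfolding maximal_equilateral_def
proof (intro conjI notI)
  let ?B = "push_forward f S ` A"
  have S: "countable S" and f: "inj_on f S" "f ` S \<subseteq> \<Gamma>" "S \<subseteq> \<Gamma>'"
    using inv by (simp_all add: countably_invertible_def)
  show "equilateral (lp_space p \<Gamma>) (lp_norm p \<Gamma>) ?B"
    using A unfolding maximal_equilateral_def
    by (intro equilateral_push_forward[OF p f]) (auto simp: supp)
  assume "\<exists>B'. equilateral (lp_space p \<Gamma>) (lp_norm p \<Gamma>) B' \<and> ?B \<subset> B'"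
  then obtain B' b where B': "equilateral (lp_space p \<Gamma>) (lp_norm p \<Gamma>) B'" "?B \<subseteq> B'" "b \<in> B'" "b \<notin> ?B"
    by blast
  have eq: "equilateral (lp_space p \<Gamma>) (lp_norm p \<Gamma>) (insert b ?B)"
    using B'(2,3) by (intro equilateral_subset[OF B'(1)]) auto
  then have b: "b \<in> lp_space p \<Gamma>" unfolding equilateral_lp_iff[OF p] by blast
  define T where "T = f ` S \<union> {n\<in>\<Gamma>. \<bar>b n\<bar> powr p \<noteq> 0}"
  have T: "countable T" "f ` S \<subseteq> T" "T \<subseteq> \<Gamma>"
    using S f(2) b summable_countable_real[of "\<lambda>n. \<bar>b n\<bar> powr p" \<Gamma>]
    by (auto simp: T_def lp_space_def)
  have "\<exists>g. inj_on g T \<and> g ` T \<subseteq> \<Gamma>' \<and> (\<forall>s\<in>S. g (f s) = s)"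
    using inv T by (simp add: countably_invertible_def)
  then obtain g where g: "inj_on g T" "g ` T \<subseteq> \<Gamma>'" "\<And>s. s \<in> S \<Longrightarrow> g (f s) = s" by blast
  have bT: "b n = 0" if "n \<notin> T" for n
    using that b by (cases "n \<in> \<Gamma>") (auto simp: T_def lp_space_def)
  have back_f: "push_forward g T (push_forward f S x) = x" if "x \<in> A" for x
    using push_forward_push_forward[OF f(1) g(1) T(2) g(3)] supp[OF that] by blast
  have "equilateral (lp_space p \<Gamma>') (lp_norm p \<Gamma>') (push_forward g T ` insert b ?B)"
  proof (rule equilateral_push_forward[OF p g(1,2) T(3) _ eq])
    show "x n = 0" if "x \<in> insert b ?B" "n \<notin> T" for x n
    proof -
      have "n \<notin> f ` S" using that(2) T(2) by blast
      then show ?thesis using that bT by (auto simp: push_forward_def)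
    qed
  qed
  also have "push_forward g T ` insert b ?B = insert (push_forward g T b) A"
    using back_f by (auto simp: image_image)
  finally have E: "equilateral (lp_space p \<Gamma>') (lp_norm p \<Gamma>') (insert (push_forward g T b) A)" .
  have "push_forward g T b \<notin> A"
  proof
    assume x: "push_forward g T b \<in> A"
    have "push_forward f S (push_forward g T b) n = b n" for n
    proof (cases "n \<in> T")
      case True
      have gn: "push_forward g T b (g n) = b n" using True g(1) by (simp add: push_forward_at)
      show ?thesis
      proof (cases "n \<in> f ` S")
        case True
        then obtain s where "s \<in> S" "n = f s" by blast
        then show ?thesis using gn g(3) push_forward_at[OF f(1)] by simp
      next
        case False
        have "g n \<notin> S"
        proof
          assume "g n \<in> S"
          then have "g (f (g n)) = g n" using g(3) by simp
          then have "f (g n) = n" using g(1) T(2) True \<open>g n \<in> S\<close> by (auto dest: inj_onD)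
          then show False using False \<open>g n \<in> S\<close> by force
        qed
        then have "b n = 0" using supp[OF x] gn by simp
        then show ?thesis using False by (simp add: push_forward_def)
      qed
    next
      case False
      then show ?thesis using bT T(2) by (auto simp: push_forward_def)
    qed
    then have "b = push_forward f S (push_forward g T b)" by auto
    then show False using x B'(4) by blast
  qed
  then have "A \<subset> insert (push_forward g T b) A" by blast
  then show False using A E unfolding maximal_equilateral_def by blast
qed

text \<open>
  Only finite maximal sets matter, as infinite ones count as \<open>\<infinity>\<close>. The set \<open>R\<close> is the union
  of the supports of their elements.
\<close>
lemma m_lp_le_transfer:
  assumes p: "0 < p"
    and ex: "\<And>R. countable R \<Longrightarrow> R \<subseteq> \<Gamma>' \<Longrightarrow> \<exists>S f. R \<subseteq> S \<and> countably_invertible f S \<Gamma>' \<Gamma>"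
  shows "m_lp p \<Gamma> \<le> m_lp p \<Gamma>'"
  unfolding m_lp_def min_equilateral_def[of "lp_space p \<Gamma>'"]
proof (rule INF_greatest)
  fix A assume "A \<in> {A. maximal_equilateral (lp_space p \<Gamma>') (lp_norm p \<Gamma>') A}"
  then have A: "maximal_equilateral (lp_space p \<Gamma>') (lp_norm p \<Gamma>') A" by simp
  show "min_equilateral (lp_space p \<Gamma>) (lp_norm p \<Gamma>) \<le> ecard A"
  proof (cases "finite A")
    case True
    have lp: "A \<subseteq> lp_space p \<Gamma>'"
      using A unfolding maximal_equilateral_def equilateral_lp_iff[OF p] by blast
    define R where "R = (\<Union>x\<in>A. {n\<in>\<Gamma>'. \<bar>x n\<bar> powr p \<noteq> 0})"
    have "countable {n\<in>\<Gamma>'. \<bar>x n\<bar> powr p \<noteq> 0}" if "x \<in> A" for x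
      using lp that by (intro summable_countable_real) (auto simp: lp_space_def)
    then have "countable R" "R \<subseteq> \<Gamma>'" using True by (auto simp: R_def countable_finite)
    from ex[OF this] obtain S f where S: "R \<subseteq> S" and inv: "countably_invertible f S \<Gamma>' \<Gamma>" by blast
    have supp: "x n = 0" if "x \<in> A" "n \<notin> S" for x n
    proof (cases "n \<in> \<Gamma>'")
      case True
      then have "\<not> \<bar>x n\<bar> powr p \<noteq> 0" using that S unfolding R_def by blast
      then show ?thesis by simp
    next
      case False
      then show ?thesis using lp that(1) by (auto simp: lp_space_def)
    qed
    have "maximal_equilateral (lp_space p \<Gamma>) (lp_norm p \<Gamma>) (push_forward f S ` A)"
      by (rule maximal_equilateral_push_forward[OF p inv _ A]) (rule supp)
    then have "min_equilateral (lp_space p \<Gamma>) (lp_norm p \<Gamma>) \<le> ecard (push_forward f S ` A)"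
      unfolding min_equilateral_def by (intro INF_lower) simp
    also have "\<dots> \<le> ecard A" using True by (simp add: ecard_def card_image_le)
    finally show ?thesis .
  qed (simp add: ecard_def)
qed

text \<open>
  A countable \<open>\<Gamma>\<close> is renamed by an enumeration. For an uncountable one all reals serve as the index set:
  outside a countable set of reals there are still infinitely many, which leaves room for any countable
  set of further coordinates.
\<close>
lemma m_lp_le_real_index:
  fixes \<Gamma> :: "'a set"
  assumes p: "0 < p"
  shows "\<exists>\<Gamma>'::real set. m_lp p \<Gamma> \<le> m_lp p \<Gamma>'"
proof (cases "countable \<Gamma>")
  case True
  define h :: "'a \<Rightarrow> real" where "h = (\<lambda>n. real (to_nat_on \<Gamma> n))"
  have h: "inj_on h \<Gamma>" using inj_on_to_nat_on[OF True] by (auto simp: h_def inj_on_def)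
  define f where "f = inv_into \<Gamma> h"
  have f: "inj_on f (h ` \<Gamma>)" "f ` h ` \<Gamma> = \<Gamma>" "\<And>s. s \<in> h ` \<Gamma> \<Longrightarrow> h (f s) = s"
    unfolding f_def using h by (auto simp: inj_on_inv_into f_inv_into_f image_image)
  have "m_lp p \<Gamma> \<le> m_lp p (h ` \<Gamma>)"
  proof (rule m_lp_le_transfer[OF p])
    have "countably_invertible f (h ` \<Gamma>) (h ` \<Gamma>) \<Gamma>"
      unfolding countably_invertible_def
    proof (intro conjI allI impI exI[of _ h])
      show "countable (h ` \<Gamma>)" using True by simp
      show "inj_on f (h ` \<Gamma>)" "f ` h ` \<Gamma> \<subseteq> \<Gamma>" using f by simp_all
      fix T assume T: "countable T \<and> f ` h ` \<Gamma> \<subseteq> T \<and> T \<subseteq> \<Gamma>"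
      show "inj_on h T" using inj_on_subset[OF h] T by blast
      show "h ` T \<subseteq> h ` \<Gamma>" using T by blast
      show "\<forall>s\<in>h ` \<Gamma>. h (f s) = s" using f(3) by blast
    qed simp
    then show "\<exists>S f. R \<subseteq> S \<and> countably_invertible f S (h ` \<Gamma>) \<Gamma>" if "R \<subseteq> h ` \<Gamma>" for R
      using that by blast
  qed
  then show ?thesis ..
next
  case False
  have "m_lp p \<Gamma> \<le> m_lp p (UNIV :: real set)"
  proof (rule m_lp_le_transfer[OF p])
    fix R :: "real set" assume R: "countable R"
    have "infinite \<Gamma>" using False countable_finite by blast
    then obtain u :: "nat \<Rightarrow> 'a" where u: "inj u" "range u \<subseteq> \<Gamma>"
      using infinite_countable_subset by blast
    define f where "f = u \<circ> to_nat_on R"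
    have f: "inj_on f R" "f ` R \<subseteq> \<Gamma>"
      using u inj_on_to_nat_on[OF R] by (auto simp: f_def intro!: comp_inj_on inj_on_subset[OF u(1)])
    have "uncountable (UNIV - R)"
      using R uncountable_UNIV_real by (simp add: uncountable_minus_countable)
    then have "infinite (UNIV - R)" using countable_finite by blast
    then obtain v :: "nat \<Rightarrow> real" where v: "inj v" "range v \<subseteq> UNIV - R"
      using infinite_countable_subset by blast
    have "\<exists>g. inj_on g T \<and> g ` T \<subseteq> UNIV \<and> (\<forall>s\<in>R. g (f s) = s)" if T: "countable T" for T
    proof -
      define g where "g t = (if t \<in> f ` R then inv_into R f t else v (to_nat_on T t))" for t
      have gR: "g t \<in> R \<longleftrightarrow> t \<in> f ` R" for t
        using v(2) by (auto simp: g_def inv_into_into)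
      have "inj_on g T"
      proof (rule inj_onI)
        fix t t' assume t: "t \<in> T" "t' \<in> T" "g t = g t'"
        then have iff: "t \<in> f ` R \<longleftrightarrow> t' \<in> f ` R" using gR by metis
        show "t = t'"
        proof (cases "t \<in> f ` R")
          case True
          then show ?thesis using t(3) iff by (simp add: g_def inv_into_injective)
        next
          case False
          then have "to_nat_on T t = to_nat_on T t'" using t(3) iff v(1) by (simp add: g_def inj_eq)
          then show ?thesis using t T by simp
        qed
      qed
      moreover have "g (f s) = s" if "s \<in> R" for s
        using that f(1) by (simp add: g_def)
      ultimately show ?thesis by blast
    qed
    then have "countably_invertible f R UNIV \<Gamma>"
      unfolding countably_invertible_def using R f by simp
    then show "\<exists>S f. R \<subseteq> S \<and> countably_invertible f S UNIV \<Gamma>" by blast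
  qed
  then show ?thesis ..
qed

section \<open>The bound over all index sets\<close>

theorem corollary7:
  fixes p :: real
  assumes "1 \<le> p" and "p < 2"
  shows "equilateral_bound p < \<infinity> \<and> (\<forall>\<Gamma>::'a set. m_lp p \<Gamma> \<le> equilateral_bound p)"
proof
  obtain K where K: "\<And>\<Gamma>::real set. m_lp p \<Gamma> \<le> enat K"
    using m_lp_bounded[OF assms] by blast
  have "equilateral_bound p \<le> enat K"
    unfolding equilateral_bound_def by (intro SUP_least K)
  also have "\<dots> < \<infinity>" by simp
  finally show "equilateral_bound p < \<infinity>" .
  show "\<forall>\<Gamma>::'a set. m_lp p \<Gamma> \<le> equilateral_bound p"
  proof
    fix \<Gamma> :: "'a set"
    obtain \<Gamma>' :: "real set" where "m_lp p \<Gamma> \<le> m_lp p \<Gamma>'"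
      using m_lp_le_real_index[of p \<Gamma>] assms by auto
    also have "\<dots> \<le> equilateral_bound p"
      unfolding equilateral_bound_def by (intro SUP_upper) simp
    finally show "m_lp p \<Gamma> \<le> equilateral_bound p" .
  qed
qed

end
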